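(* Let $k\ge 1$ be an integer and let $G$ be a simple strongly connected digraph with $m$ arcs and maximum outdegree $\Delta^+(G)\le m-k$. If $m\ge 3k$ and $\alpha\in[\frac{1}{2},1)$, then $$\lambda_\alpha(G)\le \alpha(m-k)+\frac{(1-\alpha)k}{m-k}+1-\alpha.$$
   Context: A digraph is simple if it has no loops and no multiple arcs; it is strongly connected if for every ordered pair of vertices $v_i,v_j$ there is a directed path from $v_i$ to $v_j$. For a digraph $G$ with vertex set $\{v_1,\dots,v_n\}$, $d_i^+$ is the outdegree of $v_i$ (number of arcs with tail $v_i$) and $\Delta^+(G)$ the maximum outdegree. $A(G)$ is the adjacency matrix, $D(G)=\mathrm{diag}(d_1^+,\dots,d_n^+)$, and $A_\alpha(G)=\alpha D(G)+(1-\alpha)A(G)$. $\lambda_\alpha(G)$ is the eigenvalue of $A_\alpha(G)$ of largest modulus. *)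

theory Defs
  imports
    "Graph_Theory.Digraph_Component"
    "Jordan_Normal_Form.Char_Poly"
    Complex_Main
begin

text \<open>
  Matrices are indexed by \<open>0, \<dots>, n - 1\<close>, so the matrices of a digraph take an enumeration
  \<open>v\<close> of the vertices, to be used under the assumption
  \<open>bij_betw v {..<card (verts G)} (verts G)\<close>. The spectrum does not depend on its choice.
\<close>

definition adjacency_mat :: "('a, 'b) pre_digraph \<Rightarrow> (nat \<Rightarrow> 'a) \<Rightarrow> real mat" where
  "adjacency_mat G v = mat (card (verts G)) (card (verts G))
     (\<lambda>(i, j). if v i \<rightarrow>\<^bsub>G\<^esub> v j then 1 else 0)"

definition outdegree_mat :: "('a, 'b) pre_digraph \<Rightarrow> (nat \<Rightarrow> 'a) \<Rightarrow> real mat" where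
  "outdegree_mat G v = mat_diag (card (verts G)) (\<lambda>i. real (out_degree G (v i)))"

definition A_alpha :: "real \<Rightarrow> ('a, 'b) pre_digraph \<Rightarrow> (nat \<Rightarrow> 'a) \<Rightarrow> real mat" where
  "A_alpha \<alpha> G v = \<alpha> \<cdot>\<^sub>m outdegree_mat G v + (1 - \<alpha>) \<cdot>\<^sub>m adjacency_mat G v"

text \<open>
  The eigenvalue of largest modulus, where the competing eigenvalues range over the complex
  spectrum. For a strongly connected digraph with at least two vertices and \<open>0 < \<alpha> < 1\<close> the
  matrix is nonnegative and irreducible with positive diagonal, so by Perron--Frobenius there is
  exactly one such eigenvalue and it is real; hence a real-valued definite description.
\<close>

definition lambda_alpha :: "real \<Rightarrow> ('a, 'b) pre_digraph \<Rightarrow> (nat \<Rightarrow> 'a) \<Rightarrow> real" where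
  "lambda_alpha \<alpha> G v =
     (THE r. eigenvalue (map_mat complex_of_real (A_alpha \<alpha> G v)) (complex_of_real r) \<and>
        (\<forall>z. eigenvalue (map_mat complex_of_real (A_alpha \<alpha> G v)) z \<longrightarrow>
           cmod z \<le> cmod (complex_of_real r)))"

definition max_out_degree :: "('a, 'b) pre_digraph \<Rightarrow> nat" where
  "max_out_degree G = Max (out_degree G ` verts G)"

end

theory Submission
  imports Defs "Jordan_Normal_Form.Spectral_Radius"
begin

text \<open>
  If a nonnegative matrix \<open>A\<close> and a nonzero vector \<open>x \<ge> 0\<close> satisfy \<open>t x \<le> A x\<close>, then
  \<open>t\<close> is at most the spectral radius \<open>\<rho>\<close>, because \<open>A\<^sup>k x \<ge> t\<^sup>k x\<close> while the powers of \<open>A / s\<close>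
  are bounded for \<open>s > \<rho>\<close>. Let \<open>c > 0\<close> be a lower bound of the diagonal. Taking moduli in
  \<open>(A - c I) x = (z - c) x\<close> gives \<open>\<bar>z - c\<bar> + c \<le> \<rho>\<close> for every eigenvalue \<open>z\<close>, so
  \<open>\<bar>z\<bar> = \<rho>\<close> forces \<open>z = \<rho>\<close>: the eigenvalue of largest modulus exists and is unique, without
  any use of the Perron--Frobenius theorem.

  For the estimate, weight the row sums by the outdegrees: every eigenvalue of \<open>A\<^sub>\<alpha>\<close> has modulus at
  most the maximum of \<open>\<alpha> d + (1 - \<alpha>) S / d\<close> over the vertices, where \<open>d\<close> is the outdegree and
  \<open>S\<close> is the sum of the outdegrees of the out-neighbours. Here \<open>S \<le> m - d\<close> as there are no
  loops, and \<open>S \<le> d (m - k)\<close>. The second bound settles \<open>d = 1\<close>, the first one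
  \<open>2 \<le> d \<le> m - k\<close>.
\<close>

section \<open>Nonnegative matrices\<close>

lemma mult_mat_vec_index_sum:
  assumes "A \<in> carrier_mat n n" "x \<in> carrier_vec n" "i < n"
  shows "(A *\<^sub>v x) $ i = (\<Sum>j<n. A $$ (i, j) * x $ j)"
  using assms by (auto simp: scalar_prod_def lessThan_atLeast0)

lemma pow_mat_nonneg:
  fixes A :: "real mat"
  assumes A: "A \<in> carrier_mat n n" and nn: "\<And>i j. i < n \<Longrightarrow> j < n \<Longrightarrow> 0 \<le> A $$ (i, j)"
    and ij: "i < n" "j < n"
  shows "0 \<le> (A ^\<^sub>m k) $$ (i, j)"
  using ij
proof (induction k arbitrary: i j)
  case 0
  then show ?case using A by auto
next
  case (Suc k)
  have "A ^\<^sub>m k \<in> carrier_mat n n" using A by simp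
  then show ?case using A Suc nn by (auto simp: scalar_prod_def intro!: sum_nonneg mult_nonneg_nonneg)
qed

text \<open>The nonnegative matrix \<open>A ^\<^sub>m k\<close> preserves the entrywise inequality
  between \<open>q x\<close> and \<open>A x\<close>, which is the induction step.\<close>

lemma pow_mat_mult_vec_ge:
  fixes A :: "real mat"
  assumes A: "A \<in> carrier_mat n n" and nn: "\<And>i j. i < n \<Longrightarrow> j < n \<Longrightarrow> 0 \<le> A $$ (i, j)"
    and x: "x \<in> carrier_vec n" and q: "0 \<le> q"
    and sub: "\<And>i. i < n \<Longrightarrow> q * x $ i \<le> (A *\<^sub>v x) $ i"
    and i: "i < n"
  shows "q ^ k * x $ i \<le> (A ^\<^sub>m k *\<^sub>v x) $ i"
  using i
proof (induction k arbitrary: i)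
  case 0
  then show ?case using A x by auto
next
  case (Suc k)
  have Ak: "A ^\<^sub>m k \<in> carrier_mat n n" using A by simp
  have Ax: "A *\<^sub>v x \<in> carrier_vec n" using A x by auto
  have "q ^ Suc k * x $ i \<le> q * (A ^\<^sub>m k *\<^sub>v x) $ i"
    using Suc mult_left_mono[OF _ q] by (simp add: mult.assoc)
  also have "\<dots> = (\<Sum>j<n. (A ^\<^sub>m k) $$ (i, j) * (q * x $ j))"
    unfolding mult_mat_vec_index_sum[OF Ak x Suc.prems] sum_distrib_left
    by (intro sum.cong) auto
  also have "\<dots> \<le> (\<Sum>j<n. (A ^\<^sub>m k) $$ (i, j) * (A *\<^sub>v x) $ j)"
    using pow_mat_nonneg[OF A nn Suc.prems] sub by (intro sum_mono mult_left_mono) auto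
  also have "\<dots> = (A ^\<^sub>m k *\<^sub>v (A *\<^sub>v x)) $ i"
    using mult_mat_vec_index_sum[OF Ak Ax Suc.prems] by simp
  also have "A ^\<^sub>m k *\<^sub>v (A *\<^sub>v x) = A ^\<^sub>m Suc k *\<^sub>v x"
    using assoc_mult_mat_vec[OF Ak A x] by simp
  finally show ?case .
qed

text \<open>An eigenvector of \<open>A / s\<close> for \<open>z\<close> is an eigenvector of
  \<open>A\<close> for \<open>s z\<close>, so \<open>s\<close> times the modulus of \<open>z\<close>
  stays below \<open>s\<close>.\<close>

lemma spectral_radius_less_1_scaled:
  assumes A: "A \<in> carrier_mat n n" and n: "0 < n" and s: "spectral_radius A < s"
  shows "spectral_radius (complex_of_real (1 / s) \<cdot>\<^sub>m A) < 1"
proof -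
  let ?B = "complex_of_real (1 / s) \<cdot>\<^sub>m A"
  have B: "?B \<in> carrier_mat n n" using A by simp
  have "0 \<le> spectral_radius A" using spectral_radius_mem_max(1)[OF A n] by auto
  then have s0: "0 < s" using s by simp
  obtain z where z: "spectral_radius ?B = cmod z" "eigenvalue ?B z"
    using spectral_radius_mem_max(1)[OF B n] unfolding spectrum_def by auto
  then obtain x where x: "x \<in> carrier_vec n" "x \<noteq> 0\<^sub>v n" "?B *\<^sub>v x = z \<cdot>\<^sub>v x"
    using A unfolding eigenvalue_def eigenvector_def by auto
  have "A *\<^sub>v x = (of_real s * z) \<cdot>\<^sub>v x"
  proof (rule eq_vecI)
    fix i assume "i < dim_vec ((of_real s * z) \<cdot>\<^sub>v x)"
    then have i: "i < n" using x by simp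
    have "(?B *\<^sub>v x) $ i = complex_of_real (1 / s) * (A *\<^sub>v x) $ i"
      unfolding mult_mat_vec_index_sum[OF B x(1) i] mult_mat_vec_index_sum[OF A x(1) i]
        sum_distrib_left
      using A i by (intro sum.cong) auto
    then show "(A *\<^sub>v x) $ i = ((of_real s * z) \<cdot>\<^sub>v x) $ i"
      using x i s0 by (auto simp: field_simps)
  qed (use A x in auto)
  then have "eigenvalue A (of_real s * z)"
    using A x unfolding eigenvalue_def eigenvector_def by auto
  then have "cmod (of_real s * z) \<le> spectral_radius A"
    using spectral_radius_mem_max(2)[OF A n] unfolding spectrum_def by blast
  then have "s * cmod z < s * 1" using s0 s unfolding norm_mult norm_of_real by linarith
  then show ?thesis using z s0 by (simp only: mult_less_cancel_left_pos)
qed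

lemma subinvariant_le_spectral_radius:
  fixes A :: "real mat"
  assumes A: "A \<in> carrier_mat n n" and nn: "\<And>i j. i < n \<Longrightarrow> j < n \<Longrightarrow> 0 \<le> A $$ (i, j)"
    and x: "x \<in> carrier_vec n" and x0: "\<And>i. i < n \<Longrightarrow> 0 \<le> x $ i"
    and p: "p < n" "0 < x $ p"
    and sub: "\<And>i. i < n \<Longrightarrow> t * x $ i \<le> (A *\<^sub>v x) $ i"
  shows "t \<le> spectral_radius (map_mat complex_of_real A)"
proof (rule ccontr)
  let ?C = "map_mat complex_of_real A"
  have C: "?C \<in> carrier_mat n n" using A by simp
  have n: "0 < n" using p by simp
  have r0: "0 \<le> spectral_radius ?C" using spectral_radius_mem_max(1)[OF C n] by auto
  assume "\<not> ?thesis"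
  \<comment> \<open>Scaling by an \<open>s\<close> strictly between the two keeps the powers of
    \<open>A / s\<close> bounded while \<open>t / s\<close> exceeds 1.\<close>
  then obtain s where s: "spectral_radius ?C < s" "s < t"
    using dense[of "spectral_radius ?C" t] by auto
  have s0: "0 < s" using r0 s by simp
  define B where "B = (1 / s) \<cdot>\<^sub>m A"
  have B: "B \<in> carrier_mat n n" using A B_def by simp
  have nnB: "0 \<le> B $$ (i, j)" if "i < n" "j < n" for i j
    using that A nn s0 B_def by auto
  have map_B: "map_mat complex_of_real B = complex_of_real (1 / s) \<cdot>\<^sub>m ?C"
    unfolding B_def by (rule eq_matI) auto
  obtain c where c: "\<And>k. norm_bound (map_mat complex_of_real B ^\<^sub>m k) c"
    using spectral_radius_jnf_norm_bound_less_1_upper_triangular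
      [OF _ spectral_radius_less_1_scaled[OF C n s(1)], of n] C unfolding map_B by auto
  have Bc: "(B ^\<^sub>m k) $$ (i, j) \<le> c" if "i < n" "j < n" for i j k
  proof -
    have Bk: "B ^\<^sub>m k \<in> carrier_mat n n" using B by simp
    have "cmod ((map_mat complex_of_real (B ^\<^sub>m k)) $$ (i, j)) \<le> c"
      using c[of k] that Bk B unfolding norm_bound_def
      by (simp add: of_real_hom.mat_hom_pow[OF B, symmetric])
    then show ?thesis using that carrier_matD[OF Bk] by simp
  qed
  define q where "q = t / s"
  have q: "1 < q" using s s0 unfolding q_def by simp
  have subB: "q * x $ i \<le> (B *\<^sub>v x) $ i" if i: "i < n" for i
  proof -
    have "(B *\<^sub>v x) $ i = (A *\<^sub>v x) $ i / s"
      unfolding mult_mat_vec_index_sum[OF B x i] mult_mat_vec_index_sum[OF A x i]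
        sum_divide_distrib
      using A i by (intro sum.cong) (auto simp: B_def)
    then show ?thesis using sub[OF i] s0 by (simp add: q_def divide_right_mono)
  qed
  \<comment> \<open>Only at an index where \<open>x\<close> is positive does the bound on the powers
    of \<open>B\<close> limit \<open>q ^ k\<close> itself.\<close>
  have bd: "q ^ k \<le> c * (\<Sum>j<n. x $ j) / x $ p" for k
  proof -
    have Bk: "B ^\<^sub>m k \<in> carrier_mat n n" using B by simp
    have "q ^ k * x $ p \<le> (B ^\<^sub>m k *\<^sub>v x) $ p"
      using pow_mat_mult_vec_ge[OF B nnB x _ subB p(1)] q by simp
    also have "\<dots> \<le> (\<Sum>j<n. c * x $ j)"
      unfolding mult_mat_vec_index_sum[OF Bk x p(1)]
      using Bc p x0 by (intro sum_mono mult_right_mono) auto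
    finally show ?thesis using p by (simp add: field_simps sum_distrib_left)
  qed
  obtain k where "c * (\<Sum>j<n. x $ j) / x $ p < q ^ k" using real_arch_pow[OF q] by blast
  then show False using bd[of k] by simp
qed

text \<open>Subtracting \<open>c\<close> from the diagonal leaves the matrix nonnegative, so the
  triangle inequality applies to \<open>(A - c I) x = (z - c) x\<close> without changing any
  coefficient. A positive \<open>c\<close> serves to isolate the dominant eigenvalue;
  \<open>c = 0\<close> serves the row sum bound.\<close>

lemma eigenvector_modulus_shifted:
  fixes A :: "real mat"
  assumes A: "A \<in> carrier_mat n n" and nn: "\<And>i j. i < n \<Longrightarrow> j < n \<Longrightarrow> 0 \<le> A $$ (i, j)"
    and diag: "\<And>i. i < n \<Longrightarrow> c \<le> A $$ (i, i)"
    and ev: "eigenvector (map_mat complex_of_real A) x z"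
    and i: "i < n"
  shows "(cmod (z - of_real c) + c) * cmod (x $ i) \<le> (\<Sum>j<n. A $$ (i, j) * cmod (x $ j))"
proof -
  let ?C = "map_mat complex_of_real A"
  \<comment> \<open>Row \<open>i\<close> of \<open>c I\<close>.\<close>
  let ?d = "\<lambda>j. if j = i then c else 0"
  have C: "?C \<in> carrier_mat n n" using A by simp
  have x: "x \<in> carrier_vec n" "?C *\<^sub>v x = z \<cdot>\<^sub>v x"
    using ev A unfolding eigenvector_def by auto
  have "z * x $ i = (?C *\<^sub>v x) $ i" using x i by simp
  also have "\<dots> = (\<Sum>j<n. of_real (A $$ (i, j)) * x $ j)"
    unfolding mult_mat_vec_index_sum[OF C x(1) i] using A i by (intro sum.cong) auto
  finally have zi: "z * x $ i = (\<Sum>j<n. of_real (A $$ (i, j)) * x $ j)" .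
  have dC: "(\<Sum>j<n. of_real (?d j) * x $ j) = of_real c * x $ i"
    using i sum.delta[of "{..<n}" i "\<lambda>j. of_real c * x $ j"]
    by (auto simp: if_distrib if_distribR cong: if_cong)
  have dR: "(\<Sum>j<n. ?d j * cmod (x $ j)) = c * cmod (x $ i)"
    using i sum.delta[of "{..<n}" i "\<lambda>j. c * cmod (x $ j)"]
    by (auto simp: if_distrib if_distribR cong: if_cong)
  have "(z - of_real c) * x $ i = (\<Sum>j<n. of_real (A $$ (i, j) - ?d j) * x $ j)"
    by (simp only: left_diff_distrib zi of_real_diff sum_subtractf dC)
  then have "cmod (z - of_real c) * cmod (x $ i)
      = cmod (\<Sum>j<n. of_real (A $$ (i, j) - ?d j) * x $ j)"
    by (metis norm_mult)
  also have "\<dots> \<le> (\<Sum>j<n. cmod (of_real (A $$ (i, j) - ?d j) * x $ j))"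
    by (rule norm_sum)
  also have "\<dots> = (\<Sum>j<n. (A $$ (i, j) - ?d j) * cmod (x $ j))"
  proof (rule sum.cong)
    fix j assume "j \<in> {..<n}"
    then have "0 \<le> A $$ (i, j) - ?d j" using nn i diag by auto
    then show "cmod (of_real (A $$ (i, j) - ?d j) * x $ j) = (A $$ (i, j) - ?d j) * cmod (x $ j)"
      by (simp only: norm_mult norm_of_real abs_of_nonneg)
  qed simp
  also have "\<dots> = (\<Sum>j<n. A $$ (i, j) * cmod (x $ j)) - c * cmod (x $ i)"
    by (simp only: left_diff_distrib sum_subtractf dR)
  finally show ?thesis by (simp add: algebra_simps)
qed

lemma eigenvalue_shifted_modulus_le_spectral_radius:
  fixes A :: "real mat"
  assumes A: "A \<in> carrier_mat n n" and nn: "\<And>i j. i < n \<Longrightarrow> j < n \<Longrightarrow> 0 \<le> A $$ (i, j)"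
    and diag: "\<And>i. i < n \<Longrightarrow> c \<le> A $$ (i, i)"
    and ev: "eigenvalue (map_mat complex_of_real A) z"
  shows "cmod (z - of_real c) + c \<le> spectral_radius (map_mat complex_of_real A)"
proof -
  obtain x where evx: "eigenvector (map_mat complex_of_real A) x z"
    using ev unfolding eigenvalue_def by blast
  then have x: "x \<in> carrier_vec n" "x \<noteq> 0\<^sub>v n"
    using A unfolding eigenvector_def by auto
  then obtain p where p: "p < n" "x $ p \<noteq> 0" by (metis carrier_vecD eq_vecI index_zero_vec)
  let ?y = "map_vec cmod x"
  have y: "?y \<in> carrier_vec n" using x by simp
  show ?thesis
  proof (rule subinvariant_le_spectral_radius[OF A nn y _ p(1)])
    fix i assume i: "i < n"
    show "(cmod (z - of_real c) + c) * ?y $ i \<le> (A *\<^sub>v ?y) $ i"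
      unfolding mult_mat_vec_index_sum[OF A y i]
      using eigenvector_modulus_shifted[OF A nn diag evx i] x(1) i by simp
  qed (use x p in auto)
qed

text \<open>The disc about \<open>c\<close> of radius \<open>cmod z - c\<close> touches the circle
  about 0 of radius \<open>cmod z\<close> only at the positive real point. Algebraically, squaring
  leaves \<open>cmod z \<le> Re z\<close>.\<close>

lemma complex_eq_cmod_if_shifted_modulus_le:
  assumes c: "0 < c" and le: "cmod (z - of_real c) + c \<le> cmod z"
  shows "z = of_real (cmod z)"
proof -
  have "(cmod (z - of_real c))\<^sup>2 \<le> (cmod z - c)\<^sup>2"
    using le by (intro power_mono) auto
  then have "c * cmod z \<le> c * Re z"
    unfolding power2_diff by (simp add: cmod_power2 power2_diff algebra_simps)
  then have "cmod z \<le> Re z" using c by simp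
  then have re: "Re z = cmod z" using complex_Re_le_cmod[of z] by simp
  then have "Im z = 0" using cmod_power2[of z] by simp
  then show ?thesis using re by (simp add: complex_eq_iff)
qed

text \<open>The witness is the spectral radius. This makes the definite description in
  \<open>lambda_alpha\<close> meaningful.\<close>

lemma dominant_eigenvalue_unique:
  fixes A :: "real mat"
  assumes A: "A \<in> carrier_mat n n" and nn: "\<And>i j. i < n \<Longrightarrow> j < n \<Longrightarrow> 0 \<le> A $$ (i, j)"
    and n: "0 < n" and c: "0 < c" and diag: "\<And>i. i < n \<Longrightarrow> c \<le> A $$ (i, i)"
  shows "\<exists>!r. eigenvalue (map_mat complex_of_real A) (complex_of_real r) \<and>
    (\<forall>z. eigenvalue (map_mat complex_of_real A) z \<longrightarrow> cmod z \<le> cmod (complex_of_real r))"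
proof -
  let ?C = "map_mat complex_of_real A"
  let ?r = "spectral_radius ?C"
  have C: "?C \<in> carrier_mat n n" using A by simp
  have le: "cmod z \<le> ?r" if "eigenvalue ?C z" for z
    using spectral_radius_mem_max(2)[OF C n] that unfolding spectrum_def by blast
  have eq: "z = of_real ?r" if "eigenvalue ?C z" "cmod z = ?r" for z
    using complex_eq_cmod_if_shifted_modulus_le[OF c]
      eigenvalue_shifted_modulus_le_spectral_radius[OF A nn diag that(1)] that(2) by metis
  obtain z where z: "eigenvalue ?C z" "cmod z = ?r"
    using spectral_radius_mem_max(1)[OF C n] unfolding spectrum_def by auto
  have r: "eigenvalue ?C (of_real ?r)" "cmod (of_real ?r) = ?r" using eq[OF z] z by auto
  show ?thesis
  proof (rule ex1I[of _ ?r])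
    fix s assume s: "eigenvalue ?C (of_real s) \<and> (\<forall>z. eigenvalue ?C z \<longrightarrow> cmod z \<le> cmod (of_real s))"
    then have "cmod (of_real s) = ?r" using le r by (metis order_antisym)
    then show "s = ?r" using eq s of_real_eq_iff by blast
  qed (use r le in auto)
qed

text \<open>This is the maximal row sum bound for the similar matrix
  \<open>W\<^sup>-\<^sup>1 A W\<close>, where \<open>W\<close> is the diagonal matrix of the
  weights.\<close>

lemma eigenvalue_le_weighted_row_sum:
  fixes A :: "real mat"
  assumes A: "A \<in> carrier_mat n n" and nn: "\<And>i j. i < n \<Longrightarrow> j < n \<Longrightarrow> 0 \<le> A $$ (i, j)"
    and w: "\<And>i. i < n \<Longrightarrow> 0 < w i"
    and row: "\<And>i. i < n \<Longrightarrow> (\<Sum>j<n. A $$ (i, j) * w j) \<le> b * w i"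
    and ev: "eigenvalue (map_mat complex_of_real A) z"
  shows "cmod z \<le> b"
proof -
  obtain x where evx: "eigenvector (map_mat complex_of_real A) x z"
    using ev unfolding eigenvalue_def by blast
  then have x: "x \<in> carrier_vec n" "x \<noteq> 0\<^sub>v n"
    using A unfolding eigenvector_def by auto
  then obtain p where p: "p < n" "x $ p \<noteq> 0" by (metis carrier_vecD eq_vecI index_zero_vec)
  let ?f = "\<lambda>i. cmod (x $ i) / w i"
  \<comment> \<open>The row is chosen where the eigenvector is largest relative to the weights, so
    that every \<open>cmod (x $ j)\<close> is at most \<open>?f i * w j\<close>.\<close>
  obtain i where i: "i < n" "\<And>j. j < n \<Longrightarrow> ?f j \<le> ?f i"
  proof -
    have "Max (?f ` {..<n}) \<in> ?f ` {..<n}" using p by (intro Max_in) auto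
    then obtain i where "i < n" "Max (?f ` {..<n}) = ?f i" by auto
    moreover have "?f j \<le> Max (?f ` {..<n})" if "j < n" for j using that by auto
    ultimately show ?thesis using that by metis
  qed
  have fi: "0 < ?f i" using i(2)[OF p(1)] p w[OF p(1)] by (smt (verit) divide_pos_pos zero_less_norm_iff)
  have "cmod z * cmod (x $ i) \<le> (\<Sum>j<n. A $$ (i, j) * cmod (x $ j))"
    using eigenvector_modulus_shifted[OF A nn _ evx i(1), of 0] nn by simp
  also have "\<dots> \<le> (\<Sum>j<n. A $$ (i, j) * (?f i * w j))"
  proof (intro sum_mono mult_left_mono)
    fix j assume "j \<in> {..<n}"
    then show "cmod (x $ j) \<le> ?f i * w j" "0 \<le> A $$ (i, j)"
      using i(2)[of j] w[of j] nn i(1) by (auto simp: pos_divide_le_eq)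
  qed
  also have "\<dots> = ?f i * (\<Sum>j<n. A $$ (i, j) * w j)"
    unfolding sum_distrib_left by (intro sum.cong) auto
  also have "\<dots> \<le> ?f i * (b * w i)"
    using row[OF i(1)] fi by (intro mult_left_mono) auto
  also have "\<dots> = b * cmod (x $ i)" using w[OF i(1)] by simp
  finally show ?thesis using fi w[OF i(1)] by (simp add: zero_less_divide_iff)
qed

section \<open>Outdegrees\<close>

context fin_digraph
begin

lemma sum_out_degree: "(\<Sum>u\<in>verts G. out_degree G u) = card (arcs G)"
proof -
  have "arcs G = (\<Union>u\<in>verts G. out_arcs G u)" by auto
  then have "card (arcs G) = card (\<Union>u\<in>verts G. out_arcs G u)" by simp
  also have "\<dots> = (\<Sum>u\<in>verts G. card (out_arcs G u))"
    by (rule card_UN_disjoint) auto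
  finally show ?thesis by (simp add: out_degree_def)
qed

lemma card_out_neighbours_le: "card {w \<in> verts G. u \<rightarrow> w} \<le> out_degree G u"
proof -
  have "{w \<in> verts G. u \<rightarrow> w} \<subseteq> head G ` out_arcs G u" by (auto simp: arcs_ends_conv)
  then show ?thesis
    unfolding out_degree_def by (meson finite_out_arcs surj_card_le)
qed

lemma sum_out_neighbours_le_mult:
  assumes "\<And>w. w \<in> verts G \<Longrightarrow> out_degree G w \<le> D"
  shows "(\<Sum>w | w \<in> verts G \<and> u \<rightarrow> w. out_degree G w) \<le> out_degree G u * D"
proof -
  have "(\<Sum>w | w \<in> verts G \<and> u \<rightarrow> w. out_degree G w) \<le> card {w \<in> verts G. u \<rightarrow> w} * D"
    using sum_bounded_above[of "{w \<in> verts G. u \<rightarrow> w}" "out_degree G" D] assms by simp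
  then show ?thesis using card_out_neighbours_le[of u] mult_le_mono1 order_trans by blast
qed

text \<open>A path from \<open>u\<close> to the tail of some arc, extended by that arc, has a first
  step leaving \<open>u\<close>. Positivity makes the outdegrees admissible as weights.\<close>

lemma out_degree_pos:
  assumes sc: "strongly_connected G" and arcs: "arcs G \<noteq> {}" and u: "u \<in> verts G"
  shows "0 < out_degree G u"
proof -
  obtain e where e: "e \<in> arcs G" using arcs by blast
  have "u \<rightarrow>\<^sup>* tail G e" using sc u e unfolding strongly_connected_def by auto
  moreover have "tail G e \<rightarrow> head G e" using e by (auto simp: arcs_ends_conv)
  \<comment> \<open>The appended arc keeps the path nonempty even when \<open>u\<close> is the tail
    of \<open>e\<close>.\<close>
  ultimately have "(u, head G e) \<in> (arcs_ends G)\<^sup>+"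
    using reachable_rtranclI rtrancl_into_trancl1 by metis
  then obtain w where "u \<rightarrow> w" by (metis tranclD)
  then have "out_arcs G u \<noteq> {}" by (auto simp: arcs_ends_conv)
  then show ?thesis unfolding out_degree_def using finite_out_arcs[of u] by (simp add: card_gt_0_iff)
qed

end

text \<open>Without loops \<open>u\<close> is not its own out-neighbour, so its outdegree is missing
  from the sum and can be added within the total number of arcs.\<close>

lemma (in digraph) sum_out_neighbours_le_diff:
  assumes u: "u \<in> verts G"
  shows "(\<Sum>w | w \<in> verts G \<and> u \<rightarrow> w. out_degree G w) + out_degree G u \<le> card (arcs G)"
proof -
  have "(\<Sum>w | w \<in> verts G \<and> u \<rightarrow> w. out_degree G w) \<le> (\<Sum>w\<in>verts G - {u}. out_degree G w)"
    by (rule sum_mono2) (auto dest: adj_not_same)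
  then show ?thesis
    using sum.remove[OF finite_verts u, of "out_degree G"] sum_out_degree by simp
qed

section \<open>Entries and outdegree-weighted row sums of \<open>A_alpha\<close>\<close>

lemma A_alpha_carrier: "A_alpha \<alpha> G v \<in> carrier_mat (card (verts G)) (card (verts G))"
  unfolding A_alpha_def adjacency_mat_def outdegree_mat_def by auto

lemma A_alpha_index:
  assumes "i < card (verts G)" "j < card (verts G)"
  shows "A_alpha \<alpha> G v $$ (i, j) = (if j = i then \<alpha> * real (out_degree G (v i)) else 0)
    + (if v i \<rightarrow>\<^bsub>G\<^esub> v j then 1 - \<alpha> else 0)"
  using assms unfolding A_alpha_def adjacency_mat_def outdegree_mat_def mat_diag_def by auto

lemma (in fin_digraph) A_alpha_weighted_row_sum:
  assumes v: "bij_betw v {..<card (verts G)} (verts G)" and i: "i < card (verts G)"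
  shows "(\<Sum>j<card (verts G). A_alpha \<alpha> G v $$ (i, j) * real (out_degree G (v j)))
    = \<alpha> * (real (out_degree G (v i)))\<^sup>2
      + (1 - \<alpha>) * real (\<Sum>w | w \<in> verts G \<and> v i \<rightarrow> w. out_degree G w)"
proof -
  let ?n = "card (verts G)" and ?d = "\<lambda>w. real (out_degree G w)"
  have "(\<Sum>j<?n. A_alpha \<alpha> G v $$ (i, j) * ?d (v j))
      = (\<Sum>j<?n. (if j = i then \<alpha> * (?d (v i))\<^sup>2 else 0)
          + (1 - \<alpha>) * (if v i \<rightarrow> v j then ?d (v j) else 0))"
    using i by (intro sum.cong) (auto simp: A_alpha_index algebra_simps power2_eq_square)
  also have "\<dots> = \<alpha> * (?d (v i))\<^sup>2 + (1 - \<alpha>) * (\<Sum>j<?n. if v i \<rightarrow> v j then ?d (v j) else 0)"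
    using i by (simp add: sum.distrib sum_distrib_left)
  also have "(\<Sum>j<?n. if v i \<rightarrow> v j then ?d (v j) else 0)
      = (\<Sum>w\<in>verts G. if v i \<rightarrow> w then ?d w else 0)"
    by (rule sum.reindex_bij_betw[OF v])
  also have "\<dots> = (\<Sum>w | w \<in> verts G \<and> v i \<rightarrow> w. ?d w)"
    by (rule sum.inter_filter[symmetric]) simp
  finally show ?thesis by simp
qed

text \<open>With \<open>D = m - k\<close>, the case \<open>d = 1\<close> reduces to
  \<open>(2 * \<alpha> - 1) * (D - 1)\<close> being nonnegative. For larger \<open>d\<close>, the
  bound \<open>S \<le> D + k - d\<close> leaves a quadratic in \<open>d\<close> that is nonnegative
  up to \<open>d = D\<close>.\<close>

lemma row_bound_arith:
  fixes \<alpha> d k m S :: real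
  assumes \<alpha>: "1 / 2 \<le> \<alpha>" "\<alpha> < 1" and k: "1 \<le> k" and m: "3 * k \<le> m"
    and d: "d = 1 \<or> 2 \<le> d" "d \<le> m - k"
    and S: "S + d \<le> m" "S \<le> d * (m - k)"
  shows "\<alpha> * d\<^sup>2 + (1 - \<alpha>) * S \<le> (\<alpha> * (m - k) + (1 - \<alpha>) * k / (m - k) + 1 - \<alpha>) * d"
proof -
  define D where "D = m - k"
  define e where "e = k / D"
  have D: "2 * k \<le> D" "2 \<le> D" using k m D_def by auto
  have e0: "0 \<le> e" and eD: "e * D = k" using D k e_def by auto
  have goal: "\<alpha> * d\<^sup>2 + (1 - \<alpha>) * S \<le> (\<alpha> * D + (1 - \<alpha>) * (e + 1)) * d"
    using d(1)
  proof
    assume d1: "d = 1"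
    have "(1 - \<alpha>) * S \<le> (1 - \<alpha>) * D" using S(2) d1 \<alpha> D_def by (intro mult_left_mono) auto
    moreover have "0 \<le> (2 * \<alpha> - 1) * (D - 1)" using \<alpha> D by (intro mult_nonneg_nonneg) auto
    moreover have "0 \<le> (1 - \<alpha>) * e" using \<alpha> e0 by simp
    ultimately show ?thesis using d1 by (simp add: algebra_simps)
  next
    assume d2: "2 \<le> d"
    have 1: "(1 - \<alpha>) * S \<le> (1 - \<alpha>) * (D + k - d)"
      using S(1) \<alpha> D_def by (intro mult_left_mono) auto
    have dD: "0 \<le> D - d" using d D_def by simp
    \<comment> \<open>Here \<alpha> \<ge> 1/2 enters: the whole inequality then carries the common
      factor \<open>1 - \<alpha>\<close>.\<close>
    have 2: "(1 - \<alpha>) * (d * (D - d)) \<le> \<alpha> * (d * (D - d))"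
      using \<alpha> d2 dD by (intro mult_right_mono) auto
    have "0 \<le> d * (D - d) + e * d + 2 * d - D - k"
    proof -
      \<comment> \<open>This is where \<open>m \<ge> 3 * k\<close> is used, in the form
        \<open>2 * k \<le> D\<close>; it makes \<open>d - 1 - e\<close> positive for
        \<open>d \<ge> 2\<close>.\<close>
      have "e \<le> 1 / 2" using D k unfolding e_def by (simp add: pos_divide_le_eq)
      then have "0 \<le> (D - d) * (d - 1 - e)" using d2 dD by (intro mult_nonneg_nonneg) auto
      moreover have "d * (D - d) + e * d + 2 * d - D - k = (D - d) * (d - 1 - e) + d"
        using eD by (simp add: algebra_simps)
      ultimately show ?thesis using d2 by simp
    qed
    then have 3: "0 \<le> (1 - \<alpha>) * (d * (D - d) + e * d + 2 * d - D - k)"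
      using \<alpha> by simp
    show ?thesis using 1 2 3 by (simp add: algebra_simps power2_eq_square)
  qed
  have "\<alpha> * D + (1 - \<alpha>) * (e + 1) = \<alpha> * (m - k) + (1 - \<alpha>) * k / (m - k) + 1 - \<alpha>"
    by (simp add: e_def D_def algebra_simps)
  then show ?thesis using goal by simp
qed

section \<open>The bound for the eigenvalue of largest modulus\<close>

theorem theorem4p1:
  fixes G :: "('a, 'b) pre_digraph" and v :: "nat \<Rightarrow> 'a" and k m :: nat and \<alpha> :: real
  assumes "k \<ge> 1"
    and "digraph G"
    and "strongly_connected G"
    and "bij_betw v {..<card (verts G)} (verts G)"
    and "m = card (arcs G)"
    and "int (max_out_degree G) \<le> int m - int k"
    and "m \<ge> 3 * k"
    and "\<alpha> \<in> {1/2..<1}"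
  shows "lambda_alpha \<alpha> G v
    \<le> \<alpha> * (real m - real k) + (1 - \<alpha>) * real k / (real m - real k) + 1 - \<alpha>"
proof -
  interpret digraph G by fact
  let ?n = "card (verts G)" and ?A = "A_alpha \<alpha> G v" and ?d = "\<lambda>i. real (out_degree G (v i))"
  let ?b = "\<alpha> * (real m - real k) + (1 - \<alpha>) * real k / (real m - real k) + 1 - \<alpha>"
  let ?C = "map_mat complex_of_real ?A"
  have \<alpha>: "1 / 2 \<le> \<alpha>" "\<alpha> < 1" using assms(8) by auto
  have vG: "v i \<in> verts G" if "i < ?n" for i using assms(4) that by (auto simp: bij_betw_def)
  have "arcs G \<noteq> {}" using assms(1,5,7) by auto
  then have dpos: "1 \<le> ?d i" if "i < ?n" for i
    using out_degree_pos[OF assms(3) _ vG[OF that]] by simp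
  have dmax: "out_degree G u \<le> m - k" if "u \<in> verts G" for u
  proof -
    have "out_degree G u \<le> max_out_degree G" unfolding max_out_degree_def using that by auto
    then show ?thesis using assms(6) by linarith
  qed
  have n: "0 < ?n" using assms(3) finite_verts unfolding strongly_connected_def
    by (simp add: card_gt_0_iff)
  have nn: "0 \<le> ?A $$ (i, j)" if "i < ?n" "j < ?n" for i j
    using \<alpha> by (simp add: A_alpha_index[OF that])
  \<comment> \<open>The shift 1/2 works because \<alpha> \<ge> 1/2 and every outdegree is at least
    1.\<close>
  have diag: "1 / 2 \<le> ?A $$ (i, i)" if "i < ?n" for i
  proof -
    have "1 / 2 * 1 \<le> \<alpha> * ?d i" using \<alpha> dpos[OF that] by (intro mult_mono) auto
    then show ?thesis using \<alpha> by (simp add: A_alpha_index[OF that that])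
  qed
  have row: "(\<Sum>j<?n. ?A $$ (i, j) * ?d j) \<le> ?b * ?d i" if i: "i < ?n" for i
  proof -
    define S where "S = (\<Sum>w | w \<in> verts G \<and> v i \<rightarrow>\<^bsub>G\<^esub> w. out_degree G w)"
    have mk: "real (m - k) = real m - real k" using assms(7) by (simp add: of_nat_diff)
    have "real S + ?d i \<le> real m"
      using sum_out_neighbours_le_diff[OF vG[OF i]] assms(5) unfolding S_def by linarith
    moreover have "real S \<le> ?d i * (real m - real k)"
      using sum_out_neighbours_le_mult[OF dmax, of "v i"] unfolding S_def mk[symmetric]
      by (metis of_nat_le_iff of_nat_mult)
    moreover have "?d i \<le> real m - real k" using dmax[OF vG[OF i]] mk by (metis of_nat_le_iff)
    \<comment> \<open>Integrality excludes values strictly between 1 and 2, which neither case of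
      the arithmetic covers.\<close>
    moreover have "?d i = 1 \<or> 2 \<le> ?d i" using dpos[OF i] by auto
    ultimately show ?thesis
      using row_bound_arith[OF \<alpha>, of "real k" "real m" "?d i" "real S"] assms(1,7)
      unfolding A_alpha_weighted_row_sum[OF assms(4) i] S_def by simp
  qed
  \<comment> \<open>Existence and uniqueness let the definite description be unfolded to an actual
    eigenvalue.\<close>
  have "eigenvalue ?C (complex_of_real (lambda_alpha \<alpha> G v))"
    using theI'[OF dominant_eigenvalue_unique[OF A_alpha_carrier nn n _ diag]]
    unfolding lambda_alpha_def by simp
  then have "cmod (complex_of_real (lambda_alpha \<alpha> G v)) \<le> ?b"
    using dpos by (intro eigenvalue_le_weighted_row_sum[OF A_alpha_carrier nn _ row]) force+
  then show ?thesis by simp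
qed

end
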